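(* Let $G$ be a finite tree of order $n\geq3$ with a proper edge coloring $\kappa:E(G)\to[k]$. If $\mathfrak{G}_\kappa$ is a generalized toggle group, then $\mathfrak{G}_\kappa$ is primitive.
   Context: A proper edge coloring of $G$ on $k$ colors is a surjective map $\kappa:E(G)\to[k]$ such that edges sharing a vertex receive different colors. For $a\in[k]$, $\tau_a\in S_{V(G)}$ is the product of the transpositions $(i,j)$ over all edges $\{i,j\}$ colored $a$, and the coloring group $\mathfrak{G}_\kappa\le S_{V(G)}$ is the subgroup generated by $\tau_1,\dots,\tau_k$. Generalized toggle groups: for a finite set $E$ and $L\subseteq 2^E$, the toggle $t_e$ ($e\in E$) is the permutation of $L$ with $t_e(X)=X\cup\{e\}$ if $e\notin X$ and $X\cup\{e\}\in L$, $t_e(X)=X\setminus\{e\}$ if $e\in X$ and $X\setminus\{e\}\in L$, and $t_e(X)=X$ otherwise. "$\mathfrak{G}_\kappa$ is a generalized toggle group" means that the edge-colored graph $(G,\kappa)$ arises from toggles in this way: there exist a finite set $E$, a subset $L\subseteq 2^E$, a bijection $\varphi:V(G)\to L$ and an injective map $c:[k]\to E$ such that, for all distinct $u,v\in V(G)$ and $a\in[k]$, $\{u,v\}$ is an edge colored $a$ if and only if $\varphi(u)$ and $\varphi(v)$ have symmetric difference $\{c(a)\}$, and every $e\in E$ with $t_e\neq\mathrm{id}$ lies in the image of $c$ (so that $\tau_a$ corresponds to the toggle $t_{c(a)}$ and $\mathfrak{G}_\kappa$ corresponds to the toggle group generated by all toggles). A permutation group on $X$ is imprimitive if it fixes a set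 partition of $X$ that is neither the one-block partition nor the partition into singletons; otherwise it is primitive. *)

theory Defs
  imports
    "HOL-Algebra.Bij"
    "HOL-Algebra.Generated_Groups"
    "HOL-Combinatorics.Transposition"
    "HOL-Library.Disjoint_Sets"
begin

section \<open>Finite simple graphs and trees\<close>

text \<open>A graph is given by its vertex set \<open>V\<close> and its set \<open>Es\<close> of edges, each edge being a
  two-element set of vertices.\<close>

definition simple_graph :: "'v set \<Rightarrow> 'v set set \<Rightarrow> bool" where
  "simple_graph V Es \<longleftrightarrow>
     finite V \<and> (\<forall>e\<in>Es. \<exists>u\<in>V. \<exists>v\<in>V. u \<noteq> v \<and> e = {u, v})"

definition is_walk :: "'v set \<Rightarrow> 'v set set \<Rightarrow> 'v list \<Rightarrow> bool" where
  "is_walk V Es p \<longleftrightarrow>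
     p \<noteq> [] \<and> set p \<subseteq> V \<and> successively (\<lambda>u v. {u, v} \<in> Es) p"

definition connected_graph :: "'v set \<Rightarrow> 'v set set \<Rightarrow> bool" where
  "connected_graph V Es \<longleftrightarrow>
     V \<noteq> {} \<and> (\<forall>u\<in>V. \<forall>v\<in>V. \<exists>p. is_walk V Es p \<and> hd p = u \<and> last p = v)"

definition is_cycle :: "'v set \<Rightarrow> 'v set set \<Rightarrow> 'v list \<Rightarrow> bool" where
  "is_cycle V Es p \<longleftrightarrow>
     is_walk V Es p \<and> distinct p \<and> 3 \<le> length p \<and> {last p, hd p} \<in> Es"

definition is_tree :: "'v set \<Rightarrow> 'v set set \<Rightarrow> bool" where
  "is_tree V Es \<longleftrightarrow>
     simple_graph V Es \<and> connected_graph V Es \<and> (\<nexists>p. is_cycle V Es p)"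


section \<open>Proper edge colorings and the coloring group\<close>

text \<open>The color set \<open>[k]\<close> is \<open>{1..k}\<close>; the values of \<open>\<kappa>\<close> outside \<open>Es\<close> are irrelevant.\<close>

definition proper_edge_coloring ::
  "'v set set \<Rightarrow> nat \<Rightarrow> ('v set \<Rightarrow> nat) \<Rightarrow> bool" where
  "proper_edge_coloring Es k \<kappa> \<longleftrightarrow>
     \<kappa> ` Es = {1..k} \<and>
     (\<forall>e\<in>Es. \<forall>f\<in>Es. e \<noteq> f \<and> e \<inter> f \<noteq> {} \<longrightarrow> \<kappa> e \<noteq> \<kappa> f)"

definition edge_transposition :: "'v set \<Rightarrow> 'v \<Rightarrow> 'v" where
  "edge_transposition e = (THE p. \<exists>i j. i \<noteq> j \<and> e = {i, j} \<and> p = transpose i j)"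

text \<open>The product over a color class does not depend on the order of the factors, because
  the edges of one color are pairwise disjoint; see \<open>comp_fun_commute_on_color_class\<close> below.\<close>

definition color_perm ::
  "'v set \<Rightarrow> 'v set set \<Rightarrow> ('v set \<Rightarrow> nat) \<Rightarrow> nat \<Rightarrow> ('v \<Rightarrow> 'v)" where
  "color_perm V Es \<kappa> a =
     restrict (Finite_Set.fold (\<lambda>e p. edge_transposition e \<circ> p) id {e \<in> Es. \<kappa> e = a}) V"

definition coloring_group ::
  "'v set \<Rightarrow> 'v set set \<Rightarrow> nat \<Rightarrow> ('v set \<Rightarrow> nat) \<Rightarrow> ('v \<Rightarrow> 'v) set" where
  "coloring_group V Es k \<kappa> = generate (BijGroup V) (color_perm V Es \<kappa> ` {1..k})"


section \<open>Generalized toggle groups\<close>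

definition toggle :: "'e set set \<Rightarrow> 'e \<Rightarrow> ('e set \<Rightarrow> 'e set)" where
  "toggle L e = (\<lambda>X\<in>L.
     if e \<notin> X \<and> X \<union> {e} \<in> L then X \<union> {e}
     else if e \<in> X \<and> X - {e} \<in> L then X - {e}
     else X)"

text \<open>The ground set of the toggles lives in the type \<open>'e\<close>, which is an explicit parameter. A
  theorem assuming this predicate for a type variable \<open>'e\<close> covers ground sets of every type.\<close>

definition generalized_toggle_group ::
  "'e itself \<Rightarrow> 'v set \<Rightarrow> 'v set set \<Rightarrow> nat \<Rightarrow> ('v set \<Rightarrow> nat) \<Rightarrow> bool" where
  "generalized_toggle_group (_ :: 'e itself) V Es k \<kappa> \<longleftrightarrow>
     (\<exists>(E :: 'e set) (L :: 'e set set) (\<phi> :: 'v \<Rightarrow> 'e set) (c :: nat \<Rightarrow> 'e).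
        finite E \<and> L \<subseteq> Pow E \<and>
        bij_betw \<phi> V L \<and>
        inj_on c {1..k} \<and> c ` {1..k} \<subseteq> E \<and>
        (\<forall>u\<in>V. \<forall>v\<in>V. u \<noteq> v \<longrightarrow>
           (\<forall>a\<in>{1..k}. {u, v} \<in> Es \<and> \<kappa> {u, v} = a \<longleftrightarrow> sym_diff (\<phi> u) (\<phi> v) = {c a})) \<and>
        (\<forall>e\<in>E. toggle L e \<noteq> (\<lambda>X\<in>L. X) \<longrightarrow> e \<in> c ` {1..k}))"


section \<open>Primitivity\<close>

definition imprimitive :: "'x set \<Rightarrow> ('x \<Rightarrow> 'x) set \<Rightarrow> bool" where
  "imprimitive X H \<longleftrightarrow>
     (\<exists>P. partition_on X P \<and> (\<forall>g\<in>H. (\<lambda>B. g ` B) ` P = P) \<and>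
          P \<noteq> {X} \<and> P \<noteq> (\<lambda>x. {x}) ` X)"

definition primitive :: "'x set \<Rightarrow> ('x \<Rightarrow> 'x) set \<Rightarrow> bool" where
  "primitive X H \<longleftrightarrow> \<not> imprimitive X H"


section \<open>The color permutations are well defined\<close>

lemma edge_transposition_doubleton:
  assumes "i \<noteq> j"
  shows "edge_transposition {i, j} = transpose i j"
  unfolding edge_transposition_def
proof (rule the_equality)
  show "\<exists>i' j'. i' \<noteq> j' \<and> {i, j} = {i', j'} \<and> transpose i j = transpose i' j'"
    using assms by blast
  fix p
  assume "\<exists>i' j'. i' \<noteq> j' \<and> {i, j} = {i', j'} \<and> p = transpose i' j'"
  then obtain i' j' where "{i, j} = {i', j'}" "p = transpose i' j'"
    by (elim exE conjE)
  then show "p = transpose i j"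
    unfolding doubleton_eq_iff using transpose_commute[of i j] by (elim disjE conjE) simp_all
qed

lemma comp_fun_commute_on_color_class:
  assumes "simple_graph V Es" "proper_edge_coloring Es k \<kappa>"
  shows "comp_fun_commute_on {e \<in> Es. \<kappa> e = a} (\<lambda>e p. edge_transposition e \<circ> p)"
proof
  fix e f
  assume ef: "e \<in> {e \<in> Es. \<kappa> e = a}" "f \<in> {e \<in> Es. \<kappa> e = a}"
  have "edge_transposition f \<circ> edge_transposition e =
        edge_transposition e \<circ> edge_transposition f"
  proof (cases "e = f")
    case False
    then have disj: "e \<inter> f = {}"
      using ef assms(2) unfolding proper_edge_coloring_def by auto
    have edge: "\<exists>i j. i \<noteq> j \<and> d = {i, j}" if "d \<in> Es" for d
      using assms(1) that unfolding simple_graph_def by metis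
    obtain u v where uv: "u \<noteq> v" "e = {u, v}"
      using edge[of e] ef by auto
    obtain x y where xy: "x \<noteq> y" "f = {x, y}"
      using edge[of f] ef by auto
    have "u \<noteq> x" "u \<noteq> y" "v \<noteq> x" "v \<noteq> y"
      using disj uv(2) xy(2) by auto
    then show ?thesis
      unfolding uv(2) xy(2) edge_transposition_doubleton[OF uv(1)]
        edge_transposition_doubleton[OF xy(1)]
      using uv(1) xy(1) by (simp add: fun_eq_iff transpose_def)
  qed simp
  then show "(\<circ>) (edge_transposition f) \<circ> (\<circ>) (edge_transposition e) =
             (\<circ>) (edge_transposition e) \<circ> (\<circ>) (edge_transposition f)"
    by (simp add: fun_eq_iff)
qed

end

theory Submission
  imports Defs
begin

text \<open>Let a block system of the coloring group be given which is neither trivial partition.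

  Some tree edge joins two vertices of one block. Otherwise, take a shortest walk between two
  distinct vertices of the same block. Its color word maps a block to itself, and each of its
  letters moves the block it is applied to, hence every vertex of it. Repeating the
  word therefore gives an infinite walk, which never backtracks because the chosen walk is
  shortest; no finite acyclic graph has such a walk.

  So let \<open>{x, y}\<close> be an edge of color \<open>b\<close> inside a block. By connectedness some color \<open>a\<close> moves
  this block, so \<open>x\<close> and \<open>y\<close> have neighbors \<open>x'\<close> and \<open>y'\<close> along edges of color \<open>a\<close>. In the toggle
  representation \<open>x'\<close> and \<open>y'\<close> differ exactly in the element of \<open>b\<close>, so they are adjacent and
  \<open>x', x, y, y'\<close> is a cycle.\<close>

section \<open>Finite graphs: forced cycles and connectedness\<close>

lemma simple_graph_edgeD:
  assumes "simple_graph V Es" "{u, v} \<in> Es"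
  shows "u \<in> V" "v \<in> V" "u \<noteq> v"
proof -
  obtain x y where "x \<in> V" "y \<in> V" "x \<noteq> y" "{u, v} = {x, y}"
    using assms unfolding simple_graph_def by metis
  then show "u \<in> V" "v \<in> V" "u \<noteq> v"
    by (auto simp: doubleton_eq_iff)
qed

text \<open>By finiteness of \<open>V\<close> some value recurs. Between two visits with the least
  gap \<open>d\<close> all values are distinct, and gaps 1 and 2 are excluded by the absence of
  loops and of backtracking, so this stretch of the walk closes up to a cycle.\<close>

lemma is_cycle_if_nonbacktracking:
  fixes f :: "nat \<Rightarrow> 'v"
  assumes "simple_graph V Es"
    and edge: "\<And>i. {f i, f (Suc i)} \<in> Es"
    and nonback: "\<And>i. f i \<noteq> f (Suc (Suc i))"
  shows "\<exists>p. is_cycle V Es p"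
proof -
  have V: "f i \<in> V" and neq: "f i \<noteq> f (Suc i)" for i
    using simple_graph_edgeD[OF assms(1) edge] by blast+
  define returns where "returns d \<longleftrightarrow> 0 < d \<and> (\<exists>i. f i = f (i + d))" for d
  have "finite (range f)"
    using V assms(1) by (auto simp: simple_graph_def intro: finite_subset)
  then have "\<not> inj f"
    using finite_imageD by blast
  then obtain i j where "i < j" "f i = f j"
    unfolding inj_def by (metis nat_neq_iff)
  then have "returns (j - i)"
    using \<open>i < j\<close> \<open>f i = f j\<close> unfolding returns_def by (intro conjI exI[of _ i]) auto
  then obtain d where "returns d" and min: "\<And>m. m < d \<Longrightarrow> \<not> returns m"
    using exists_least_iff[of returns] by blast
  then obtain i where i: "0 < d" "f i = f (i + d)"
    unfolding returns_def by blast
  have "d \<noteq> 1" "d \<noteq> 2"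
    using i neq[of i] nonback[of i] by auto
  then have d: "3 \<le> d"
    using i by linarith
  have inj: "inj_on f {i..<i + d}"
  proof (rule linorder_inj_onI)
    fix x y assume "x < y" "x \<in> {i..<i + d}" "y \<in> {i..<i + d}"
    then have "0 < y - x" "y - x < d" "x + (y - x) = y"
      by auto
    then show "f x \<noteq> f y"
      using min[of "y - x"] unfolding returns_def by metis
  qed auto
  have "{f (i + d - 1), f i} \<in> Es"
    using edge[of "i + d - 1"] i by simp
  then have "is_cycle V Es (map f [i..<i + d])"
    using d V inj edge
    by (auto simp: is_cycle_def is_walk_def successively_conv_nth distinct_map last_map hd_map)
  then show ?thesis ..
qed

lemma connected_graph_closed:
  assumes "connected_graph V Es" "u \<in> V" "u \<in> S" "v \<in> V"
    and closed: "\<And>x y. {x, y} \<in> Es \<Longrightarrow> x \<in> S \<Longrightarrow> y \<in> S"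
  shows "v \<in> S"
proof -
  obtain p where p: "is_walk V Es p" "hd p = u" "last p = v"
    using assms(1,2,4) unfolding connected_graph_def by blast
  have "p \<noteq> [] \<Longrightarrow> successively (\<lambda>x y. {x, y} \<in> Es) p \<Longrightarrow> hd p \<in> S \<Longrightarrow> last p \<in> S"
    by (induction p rule: induct_list012) (auto dest: closed)
  then show ?thesis
    using p assms(3) unfolding is_walk_def by blast
qed

section \<open>Action of the color permutations on vertices\<close>

lemma fold_edge_transposition:
  assumes "simple_graph V Es" "proper_edge_coloring Es k \<kappa>"
    and "finite S" "S \<subseteq> {e \<in> Es. \<kappa> e = a}"
  defines "g \<equiv> Finite_Set.fold (\<lambda>e p. edge_transposition e \<circ> p) id S"
  shows "({u, v} \<in> S \<longrightarrow> g u = v) \<and> (u \<notin> \<Union>S \<longrightarrow> g u = u)"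
  using assms(3,4) unfolding g_def
proof (induction S arbitrary: u v)
  case (insert e S)
  interpret comp_fun_commute_on "{e \<in> Es. \<kappa> e = a}" "\<lambda>e p. edge_transposition e \<circ> p"
    using comp_fun_commute_on_color_class assms by blast
  let ?g = "Finite_Set.fold (\<lambda>e p. edge_transposition e \<circ> p) id S"
  have IH: "{u, v} \<in> S \<longrightarrow> ?g u = v" "u \<notin> \<Union>S \<longrightarrow> ?g u = u" for u v
    using insert.IH insert.prems by blast+
  obtain i j where ij: "i \<noteq> j" "e = {i, j}"
    using insert.prems assms(1) unfolding simple_graph_def by blast
  have fold: "Finite_Set.fold (\<lambda>e p. edge_transposition e \<circ> p) id (insert e S)
      = transpose i j \<circ> ?g"
    using fold_insert[of e S id] insert.prems insert.hyps ij
    by (simp add: edge_transposition_doubleton)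
  \<comment> \<open>Edges of one color are pairwise disjoint because the coloring is proper. Hence
    \<open>?g\<close> fixes both ends of \<open>e\<close>, and \<open>transpose i j\<close> fixes
    every vertex on an edge of \<open>S\<close>.\<close>
  have disj: "e \<inter> f = {}" if "f \<in> S" for f
  proof -
    have "e \<in> Es" "f \<in> Es" "\<kappa> e = \<kappa> f" "e \<noteq> f"
      using that insert.prems insert.hyps by auto
    then show ?thesis
      using assms(2) unfolding proper_edge_coloring_def by metis
  qed
  then have away: "i \<notin> \<Union>S" "j \<notin> \<Union>S"
    using ij by auto
  show ?case
    unfolding fold
  proof (intro conjI impI)
    assume "{u, v} \<in> insert e S"
    then consider "{u, v} = {i, j}" | "{u, v} \<in> S"
      using ij by blast
    then show "(transpose i j \<circ> ?g) u = v"
    proof cases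
      case 1
      then show ?thesis
        using IH(2) away by (auto simp: doubleton_eq_iff)
    next
      case 2
      then have "v \<noteq> i" "v \<noteq> j"
        using away by auto
      then show ?thesis
        using 2 IH(1) by simp
    qed
  next
    assume "u \<notin> \<Union>(insert e S)"
    then show "(transpose i j \<circ> ?g) u = u"
      using IH(2) ij by simp
  qed
qed simp

section \<open>Block systems, encoded as invariant equivalence relations\<close>

locale colored_tree_blocks =
  fixes V :: "'v set" and Es :: "'v set set" and k :: nat and \<kappa> :: "'v set \<Rightarrow> nat"
    and R :: "('v \<times> 'v) set"
  assumes tree: "is_tree V Es"
    and coloring: "proper_edge_coloring Es k \<kappa>"
    and equiv: "equiv V R"
    and invariant: "\<And>a x y. a \<in> {1..k} \<Longrightarrow> (x, y) \<in> R \<Longrightarrow>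
      (color_perm V Es \<kappa> a x, color_perm V Es \<kappa> a y) \<in> R"
begin

abbreviation \<tau> :: "nat \<Rightarrow> 'v \<Rightarrow> 'v" where
  "\<tau> a \<equiv> color_perm V Es \<kappa> a"

lemma graph: "simple_graph V Es" and connected: "connected_graph V Es"
  and acyclic: "\<not> is_cycle V Es p"
  using tree unfolding is_tree_def by blast+

lemmas edgeD = simple_graph_edgeD[OF graph]

lemma color_in: "{x, y} \<in> Es \<Longrightarrow> \<kappa> {x, y} \<in> {1..k}"
  using coloring unfolding proper_edge_coloring_def by blast

lemma finite_color_class: "finite {e \<in> Es. \<kappa> e = a}"
proof -
  have "Es \<subseteq> Pow V" "finite V"
    using graph unfolding simple_graph_def by auto
  then show ?thesis
    by (simp add: finite_subset)
qed

lemma color_perm_edge: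
  assumes "{x, y} \<in> Es"
  shows "\<tau> (\<kappa> {x, y}) x = y"
  using fold_edge_transposition[OF graph coloring finite_color_class order_refl, of x y]
    assms edgeD[OF assms]
  by (simp add: color_perm_def)

lemma color_perm_moved:
  assumes "x \<in> V" "\<tau> a x \<noteq> x"
  shows "{x, \<tau> a x} \<in> Es" "\<kappa> {x, \<tau> a x} = a"
proof -
  have "x \<in> \<Union>{e \<in> Es. \<kappa> e = a}"
    using fold_edge_transposition[OF graph coloring finite_color_class order_refl, of x x a]
      assms by (auto simp: color_perm_def)
  then obtain e where e: "e \<in> Es" "\<kappa> e = a" "x \<in> e"
    by blast
  moreover obtain u v where "e = {u, v}"
    using graph e(1) unfolding simple_graph_def by metis
  ultimately obtain y where "e = {x, y}"
    by blast
  then show "{x, \<tau> a x} \<in> Es" "\<kappa> {x, \<tau> a x} = a"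
    using e color_perm_edge by auto
qed

lemma color_perm_involution: "x \<in> V \<Longrightarrow> \<tau> a (\<tau> a x) = x"
  by (metis color_perm_edge color_perm_moved insert_commute)

lemma R_in: "(x, y) \<in> R \<Longrightarrow> x \<in> V \<and> y \<in> V"
  using equiv unfolding equiv_def by blast

lemma R_refl: "x \<in> V \<Longrightarrow> (x, x) \<in> R"
  using equiv unfolding equiv_def refl_on_def by blast

lemma R_sym: "(x, y) \<in> R \<Longrightarrow> (y, x) \<in> R"
  using equiv unfolding equiv_def sym_def by blast

lemma R_trans: "(x, y) \<in> R \<Longrightarrow> (y, z) \<in> R \<Longrightarrow> (x, z) \<in> R"
  using equiv unfolding equiv_def trans_def by blast

text \<open>Otherwise the class of \<open>x\<close> is closed under adjacency: if
  \<open>(x, u) \<in> R\<close> and \<open>{u, v}\<close> has color \<open>a\<close>, then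
  \<open>v = \<tau> a u\<close> is related to \<open>\<tau> a x\<close>, which is related to
  \<open>x\<close>. Connectedness then makes the class all of \<open>V\<close>.\<close>

lemma ex_color_moving_block:
  assumes "R \<noteq> V \<times> V" "x \<in> V"
  shows "\<exists>a\<in>{1..k}. (x, \<tau> a x) \<notin> R"
proof (rule ccontr)
  assume "\<not> ?thesis"
  then have fixed: "(x, \<tau> a x) \<in> R" if "a \<in> {1..k}" for a
    using that by blast
  have "(x, v) \<in> R" if "(x, u) \<in> R" "{u, v} \<in> Es" for u v
    using fixed[OF color_in] invariant[OF color_in] color_perm_edge that R_trans by metis
  then have "(x, v) \<in> R" if "v \<in> V" for v
    using connected_graph_closed[OF connected, of x "R `` {x}" v] assms(2) R_refl that by blast
  then have "(u, v) \<in> R" if "u \<in> V" "v \<in> V" for u v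
    using that R_sym R_trans by metis
  then have "R = V \<times> V"
    using R_in by auto
  with assms(1) show False ..
qed

lemma ex_edge_in_block:
  assumes "R \<noteq> Id_on V"
  shows "\<exists>x y. {x, y} \<in> Es \<and> (x, y) \<in> R"
proof (rule ccontr)
  assume "\<not> ?thesis"
  then have crossing: "(x, y) \<notin> R" if "{x, y} \<in> Es" for x y
    using that by blast
  \<comment> \<open>If \<open>a\<close> fixed \<open>x\<close> but moved \<open>y\<close>, then
    \<open>\<tau> a y\<close> would be related to \<open>x\<close> and so to \<open>y\<close>, and
    the edge between \<open>y\<close> and \<open>\<tau> a y\<close> would lie inside a
    class.\<close>
  have moves: "\<tau> a x \<noteq> x" if "a \<in> {1..k}" "(x, y) \<in> R" "\<tau> a y \<noteq> y" for a x y
    using crossing[of y "\<tau> a y"] color_perm_moved(1)[of y a] invariant[of a x y]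
      that R_in R_sym R_trans by metis
  \<comment> \<open>With a walk given by a function and a length, the shortcuts below, which remove
    two steps, become index arithmetic; values of \<open>v\<close> beyond \<open>r\<close> do not
    matter.\<close>
  define walk where "walk r v \<longleftrightarrow>
    (\<forall>i<r. {v i, v (Suc i)} \<in> Es) \<and> v 0 \<noteq> v r \<and> (v 0, v r) \<in> R" for r and v :: "nat \<Rightarrow> 'v"
  have "R = Id_on V" if "\<And>x y. (x, y) \<in> R \<Longrightarrow> x = y"
    using that R_in R_refl by (auto simp: Id_on_iff)
  then obtain x y where xy: "(x, y) \<in> R" "x \<noteq> y"
    using assms by blast
  then obtain p where p: "is_walk V Es p" "hd p = x" "last p = y"
    using connected R_in unfolding connected_graph_def by metis
  have "walk (length p - 1) ((!) p)"
    using p xy unfolding walk_def is_walk_def successively_conv_nth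
    by (auto simp: hd_conv_nth last_conv_nth)
  then obtain r where "\<exists>v. walk r v" and min: "\<And>m v. m < r \<Longrightarrow> \<not> walk m v"
    using exists_least_iff[of "\<lambda>r. \<exists>v. walk r v"] by blast
  then obtain v where edge: "\<And>i. i < r \<Longrightarrow> {v i, v (Suc i)} \<in> Es"
    and ends: "v 0 \<noteq> v r" "(v 0, v r) \<in> R"
    unfolding walk_def by blast
  define d where "d i = \<kappa> {v i, v (Suc i)}" for i
  have d: "d i \<in> {1..k}" "\<tau> (d i) (v i) = v (Suc i)" "\<tau> (d i) (v (Suc i)) = v i" if "i < r" for i
    unfolding d_def using edge[OF that] color_in color_perm_edge
    by (auto, metis insert_commute)
  have r: "0 < r"
    using ends(1) by (metis gr0I)
  have straight: "d i \<noteq> d (Suc i)" if "Suc i < r" for i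
  proof
    assume "d i = d (Suc i)"
    then have eq: "v (Suc (Suc i)) = v i"
      using d(3)[of i] d(2)[of "Suc i"] that by simp
    \<comment> \<open>Skips the detour from \<open>v i\<close> to \<open>v (Suc i)\<close> and back,
      which saves two steps and keeps both ends.\<close>
    define w where "w j = (if j \<le> i then v j else v (Suc (Suc j)))" for j
    have "{w j, w (Suc j)} \<in> Es" if "j < r - 2" for j
      using edge[of j] edge[of "Suc (Suc j)"] that eq
      by (cases "j = i") (auto simp: w_def)
    moreover have "w 0 = v 0"
      by (simp add: w_def)
    moreover have "w (r - 2) = v r"
    proof (cases "r - 2 \<le> i")
      case True
      then have "r = Suc (Suc i)"
        using that by linarith
      then show ?thesis
        using eq by (simp add: w_def)
    next
      case False
      then have "Suc (Suc (r - 2)) = r"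
        by linarith
      then show ?thesis
        using False by (simp add: w_def)
    qed
    ultimately have "walk (r - 2) w"
      using ends by (simp add: walk_def)
    then show False
      using min[of "r - 2"] r by simp
  qed
  \<comment> \<open>The word is reduced cyclically, too. If its first and last letters agree,
    dropping both steps leaves a walk from \<open>v 1\<close> to \<open>v (r - 1)\<close>. These are
    the images of \<open>v 0\<close> and \<open>v r\<close> under \<open>\<tau> (d 0)\<close>, hence
    again distinct and related.\<close>
  have wrap: "d (r - 1) \<noteq> d 0"
  proof
    assume eq: "d (r - 1) = d 0"
    have V: "v 0 \<in> V" "v r \<in> V"
      using ends R_in by auto
    have first: "v 1 = \<tau> (d 0) (v 0)" and last: "v (r - 1) = \<tau> (d 0) (v r)"
      using d[of 0] d[of "r - 1"] r eq by auto
    have neq: "v 1 \<noteq> v (r - 1)"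
      using first last color_perm_involution V ends(1) by metis
    have rel: "(v 1, v (r - 1)) \<in> R"
      using first last invariant[OF d(1)[OF r] ends(2)] by simp
    have "r \<noteq> 1"
      using crossing[OF edge[of 0]] ends(2) by auto
    moreover have "r \<noteq> 2"
      using neq by auto
    ultimately have "3 \<le> r"
      using r by linarith
    then have "walk (r - 2) (\<lambda>j. v (Suc j))"
      using edge neq rel unfolding walk_def
      by (auto simp: Suc_diff_Suc numeral_2_eq_2 numeral_3_eq_3)
    then show False
      using min[of "r - 2"] r by simp
  qed
  \<comment> \<open>Applies the letters of the word over and over. Since
    \<open>v r \<noteq> v 0\<close>, the vertices need not agree with those of \<open>v\<close>
    after the first round; only the class of \<open>v (i mod r)\<close> is kept.\<close>
  define f where "f = rec_nat (v 0) (\<lambda>i. \<tau> (d (i mod r)))"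
  have f_Suc: "f (Suc i) = \<tau> (d (i mod r)) (f i)" for i
    by (simp add: f_def)
  have rel: "(f i, v (i mod r)) \<in> R" for i
  proof (induction i)
    case 0
    then show ?case
      using ends R_in R_refl by (simp add: f_def)
  next
    case (Suc i)
    have lt: "i mod r < r"
      using r by simp
    have "(f (Suc i), v (Suc (i mod r))) \<in> R"
      using invariant[OF d(1)[OF lt] Suc] d(2)[OF lt] f_Suc by simp
    moreover have "(v r, v 0) \<in> R"
      using ends R_sym by blast
    ultimately show ?case
      using R_trans by (cases "Suc (i mod r) = r") (simp_all add: mod_Suc)
  qed
  \<comment> \<open>The letter moves \<open>v (i mod r)\<close>, which shares a class with
    \<open>f i\<close>, so by \<open>moves\<close> it moves \<open>f i\<close> as well.\<close>
  have f_edge: "{f i, f (Suc i)} \<in> Es" and f_color: "\<kappa> {f i, f (Suc i)} = d (i mod r)" for i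
  proof -
    have lt: "i mod r < r"
      using r by simp
    have "\<tau> (d (i mod r)) (f i) \<noteq> f i"
      using moves[OF d(1)[OF lt] rel] d(2)[OF lt] edgeD(3)[OF edge[OF lt]] by simp
    then show "{f i, f (Suc i)} \<in> Es" "\<kappa> {f i, f (Suc i)} = d (i mod r)"
      using color_perm_moved[of "f i" "d (i mod r)"] rel[of i] R_in f_Suc by auto
  qed
  \<comment> \<open>Backtracking would use one edge twice in a row, making two cyclically
    consecutive letters equal.\<close>
  have "f i \<noteq> f (Suc (Suc i))" for i
  proof
    assume "f i = f (Suc (Suc i))"
    then have "d (i mod r) = d (Suc i mod r)"
      using f_color[of i] f_color[of "Suc i"] by (simp add: insert_commute)
    moreover have "d (i mod r) \<noteq> d (Suc i mod r)"
    proof (cases "Suc (i mod r) = r")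
      case True
      then have "i mod r = r - 1"
        by linarith
      then show ?thesis
        using True wrap by (simp add: mod_Suc)
    next
      case False
      moreover have "i mod r < r"
        using r by simp
      ultimately show ?thesis
        using straight[of "i mod r"] by (simp add: mod_Suc)
    qed
    ultimately show False
      by blast
  qed
  then show False
    using is_cycle_if_nonbacktracking[where f = f, OF graph f_edge] acyclic by blast
qed

section \<open>Toggle representations: closing a four-cycle\<close>

lemma trivial_blocks_if_toggle_group:
  assumes "generalized_toggle_group TYPE('e) V Es k \<kappa>"
  shows "R = V \<times> V \<or> R = Id_on V"
proof (rule ccontr)
  assume nontrivial: "\<not> ?thesis"
  obtain \<phi> :: "'v \<Rightarrow> 'e set" and c :: "nat \<Rightarrow> 'e" where
    toggle: "\<And>u v a. u \<in> V \<Longrightarrow> v \<in> V \<Longrightarrow> u \<noteq> v \<Longrightarrow> a \<in> {1..k} \<Longrightarrow>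
      {u, v} \<in> Es \<and> \<kappa> {u, v} = a \<longleftrightarrow> sym_diff (\<phi> u) (\<phi> v) = {c a}"
    using assms unfolding generalized_toggle_group_def by metis
  have diff: "sym_diff (\<phi> u) (\<phi> v) = {c (\<kappa> {u, v})}" if "{u, v} \<in> Es" for u v
    using toggle[of u v "\<kappa> {u, v}"] edgeD[OF that] color_in[OF that] that by blast
  obtain x y where xy: "{x, y} \<in> Es" "(x, y) \<in> R"
    using ex_edge_in_block nontrivial by blast
  note xy' = edgeD[OF xy(1)]
  obtain a where a: "a \<in> {1..k}" "(x, \<tau> a x) \<notin> R"
    using ex_color_moving_block nontrivial xy' by blast
  define x' y' where "x' = \<tau> a x" and "y' = \<tau> a y"
  have rel: "(x', y') \<in> R"
    unfolding x'_def y'_def using invariant a(1) xy(2) .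
  have out: "(x, x') \<notin> R" "(y, y') \<notin> R"
    using a(2) rel xy(2) R_sym R_trans unfolding x'_def by blast+
  then have moved: "x' \<noteq> x" "y' \<noteq> y"
    using R_refl xy' by auto
  then have edges: "{x, x'} \<in> Es" "\<kappa> {x, x'} = a" "{y, y'} \<in> Es" "\<kappa> {y, y'} = a"
    using color_perm_moved[of x a] color_perm_moved[of y a] xy' unfolding x'_def y'_def by auto
  \<comment> \<open>\<open>x' = y'\<close> would give \<open>x = y\<close> by the involution; either
    of the other coincidences would put \<open>x'\<close> or \<open>y'\<close> back into the class
    it has left.\<close>
  have neq: "x' \<noteq> y'" "x' \<noteq> y" "y' \<noteq> x"
    using xy' color_perm_involution out xy(2) R_sym unfolding x'_def y'_def by metis+
  have "sym_diff (\<phi> x) (\<phi> x') = {c a}" "sym_diff (\<phi> y) (\<phi> y') = {c a}"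
    using diff edges by metis+
  \<comment> \<open>Both passages toggle the same element \<open>c a\<close>, which cancels in the
    symmetric difference.\<close>
  then have "sym_diff (\<phi> x') (\<phi> y') = sym_diff (\<phi> x) (\<phi> y)"
    by blast
  then have "sym_diff (\<phi> x') (\<phi> y') = {c (\<kappa> {x, y})}"
    using diff[OF xy(1)] by simp
  \<comment> \<open>Here the representation is read backwards: differing in the single element of a
    color forces an edge.\<close>
  then have "{x', y'} \<in> Es"
    using toggle[of x' y' "\<kappa> {x, y}"] neq(1) color_in[OF xy(1)] edgeD edges by blast
  then have "is_cycle V Es [x', x, y, y']"
    using edges xy xy' neq moved edgeD(2)[OF edges(1)] edgeD(2)[OF edges(3)]
    by (auto simp: is_cycle_def is_walk_def insert_commute)
  then show False
    using acyclic by blast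
qed

end

section \<open>From block systems to equivalence relations\<close>

theorem theorem4p4:
  fixes V :: "'v set" and Es :: "'v set set" and n k :: nat and \<kappa> :: "'v set \<Rightarrow> nat"
  assumes "is_tree V Es"
    and "card V = n" and "n \<ge> 3"
    and "proper_edge_coloring Es k \<kappa>"
    and "generalized_toggle_group TYPE('e) V Es k \<kappa>"
  shows "primitive V (coloring_group V Es k \<kappa>)"
  unfolding primitive_def
proof
  assume "imprimitive V (coloring_group V Es k \<kappa>)"
  then obtain P where P: "partition_on V P"
    and inv: "\<And>g. g \<in> coloring_group V Es k \<kappa> \<Longrightarrow> (\<lambda>B. g ` B) ` P = P"
    and nontrivial: "P \<noteq> {V}" "P \<noteq> (\<lambda>x. {x}) ` V"
    unfolding imprimitive_def by metis
  define R where "R = {(x, y). \<exists>B\<in>P. x \<in> B \<and> y \<in> B}"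
  have block: "B = R `` {x}" if "B \<in> P" "x \<in> B" for B x
  proof -
    have "C = B" if "C \<in> P" "x \<in> C" for C
      using that \<open>B \<in> P\<close> \<open>x \<in> B\<close> partition_onD2[OF P] unfolding disjoint_def by blast
    then show ?thesis
      using that unfolding R_def by blast
  qed
  have union: "\<Union>P = V" and nonempty: "\<And>B. B \<in> P \<Longrightarrow> B \<noteq> {}"
    using P unfolding partition_on_def by blast+
  \<comment> \<open>Recovers the blocks as the classes of \<open>R\<close>, so that triviality of
    \<open>R\<close> carries over to \<open>P\<close>.\<close>
  have blocks: "P = (\<lambda>x. R `` {x}) ` V"
  proof (intro equalityI subsetI)
    fix B assume B: "B \<in> P"
    then obtain x where x: "x \<in> B"
      using nonempty by blast
    then have "x \<in> V"
      using B union by blast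
    then show "B \<in> (\<lambda>x. R `` {x}) ` V"
      using block[OF B x] by (rule rev_image_eqI)
  next
    fix B assume "B \<in> (\<lambda>x. R `` {x}) ` V"
    then obtain x where x: "x \<in> V" "B = R `` {x}"
      by blast
    then obtain C where "C \<in> P" "x \<in> C"
      using union by blast
    then show "B \<in> P"
      using block[of C x] x(2) by simp
  qed
  \<comment> \<open>For \<open>R = V \<times> V\<close> this makes the set of classes
    \<open>{V}\<close> and not empty.\<close>
  have V: "V \<noteq> {}"
    using assms(2,3) by auto
  interpret colored_tree_blocks V Es k \<kappa> R
  proof
    show "equiv V R"
      unfolding R_def using equiv_partition_on[OF P] .
    fix a x y assume a: "a \<in> {1..k}" and "(x, y) \<in> R"
    then obtain B where B: "B \<in> P" "x \<in> B" "y \<in> B"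
      unfolding R_def by blast
    \<comment> \<open>As a generator of the group, the color permutation maps the block
      \<open>B\<close> onto a block.\<close>
    have "color_perm V Es \<kappa> a \<in> coloring_group V Es k \<kappa>"
      unfolding coloring_group_def using a by (intro generate.incl) blast
    then have "color_perm V Es \<kappa> a ` B \<in> P"
      using inv B(1) by blast
    then show "(color_perm V Es \<kappa> a x, color_perm V Es \<kappa> a y) \<in> R"
      unfolding R_def using B by blast
  qed (fact assms)+
  from trivial_blocks_if_toggle_group[OF assms(5)] show False
  proof
    assume "R = V \<times> V"
    then have "P = {V}"
      unfolding blocks using V by auto
    with nontrivial show False by blast
  next
    assume "R = Id_on V"
    then have "P = (\<lambda>x. {x}) ` V"
      unfolding blocks by (intro image_cong) auto
    with nontrivial show False by blast
  qed
qed

end
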